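(* Let $m,n$ be non-negative integers with $n-2\geq m$, and let $$q(z)=b_mz^m+\ldots+b_1z,\qquad p(\bar z)=\bar z^n+a_{n-1}\bar z^{n-1}+\ldots+a_1\bar z+a_0$$ be polynomials with complex coefficients, with $\deg q=m$ (if $m=0$ then $q=0$). Let $h(z,\bar z)=q(z)+p(\bar z)$. Then the number of distinct solutions $z\in\mathbb{C}$ of the equation $h(z,\bar z)=0$ is at most $n^2-1$ if $(n-1)a_{n-1}^2-2na_{n-2}=0$, and at most $n^2-2$ otherwise.
   Context: Here $\bar z$ denotes the complex conjugate of $z\in\mathbb{C}$. *)

theory Defs
  imports Complex_Main "HOL-Computational_Algebra.Polynomial"
begin

end

theory Submission imports Defs begin

text \<open>
  Translating \<open>z\<close> makes the subleading coefficient of \<open>p\<close> vanish, at the price of a constant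
  term in \<open>q\<close>. Write \<open>w\<close> for the conjugate of \<open>z\<close>. The equation and its conjugate then
  express \<open>w^n\<close> and \<open>z^n\<close> by \<open>z^k\<close> and \<open>w^k\<close> with \<open>k \<le> n - 2\<close>. Regarding \<open>z\<close> and \<open>w\<close>
  as independent variables, these are two plane curves whose coordinate algebra \<open>A\<close> has the
  monomials \<open>z^i w^j\<close> with \<open>i, j < n\<close> as a basis, so it has dimension \<open>n^2\<close> and there are
  \<open>n^2\<close> common points counted with multiplicity. The trace of multiplication by \<open>z w\<close> on \<open>A\<close>
  is the sum of the products \<open>z w\<close> over these points. It is zero, because in the monomial basis
  every diagonal entry of this multiplication vanishes; this is where the gap
  \<open>degree q \<le> n - 2\<close> and the vanishing subleading coefficient enter.

  On a solution of the original equation \<open>z w = |z|^2 \<ge> 0\<close>. Suppose there were a set \<open>S\<close> of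
  exactly \<open>n^2 - 1\<close> such solutions. Then one common point, possibly a repeated one, is missing,
  and since complex conjugation exchanges the two curves, the missing point
  also has \<open>w\<close> conjugate to \<open>z\<close>. So a sum of squared moduli over all points vanishes, every point
  is the origin, and
  \<open>n^2 - 1 \<le> 1\<close>, which contradicts \<open>n \<ge> 2\<close>. Excluding finite sets of exactly \<open>n^2 - 1\<close>
  zeros bounds the number of zeros by \<open>n^2 - 2\<close>, and this implies both alternatives.

  Below, elements of \<open>A\<close> are represented by coefficient arrays, and the multiplications by \<open>z\<close>
  and \<open>w\<close> by explicit linear maps on arrays. Evaluation at the points of \<open>S\<close> is onto, so its kernel is a line, and this line plays the part of the
  missing point: it is spanned by a common eigenvector of the two multiplications, with conjugate
  eigenvalues (\<open>card_zero_set_neq\<close>). The lemma \<open>trace_eq_sum_eigenvalues\<close> turns this into the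
  formula for the trace, and \<open>Mz_Bw_diagonal\<close> shows that the diagonal is zero.
\<close>

section \<open>Linear functionals with a one-dimensional common kernel\<close>

text \<open>
  The linear extension of a map given on the standard basis: \<open>B y\<close> is the image of the basis
  vector with index \<open>y\<close>.
\<close>

definition lin :: "'j set \<Rightarrow> ('j \<Rightarrow> 'i \<Rightarrow> 'a::field) \<Rightarrow> ('j \<Rightarrow> 'a) \<Rightarrow> 'i \<Rightarrow> 'a" where
  "lin J B v x = (\<Sum>y\<in>J. v y * B y x)"

definition unit_vec :: "'j \<Rightarrow> 'j \<Rightarrow> 'a::field" where
  "unit_vec y x = (if x = y then 1 else 0)"

lemma lin_cong: "(\<And>y. y \<in> J \<Longrightarrow> v y = v' y) \<Longrightarrow> lin J B v x = lin J B v' x"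
  by (simp add: lin_def)

lemma lin_unit_vec: "finite J \<Longrightarrow> y \<in> J \<Longrightarrow> lin J B (unit_vec y) x = B y x"
  by (simp add: lin_def unit_vec_def if_distrib[of "\<lambda>t. t * _"] cong: if_cong)

lemma lin_add: "lin J B (\<lambda>y. u y + v y) x = lin J B u x + lin J B v x"
  by (simp add: lin_def algebra_simps sum.distrib)

lemma lin_scale: "lin J B (\<lambda>y. c * v y) x = c * lin J B v x"
  by (simp add: lin_def algebra_simps sum_distrib_left)

lemma lin_sum: "lin J B (\<lambda>y. \<Sum>i\<in>I. u i y) x = (\<Sum>i\<in>I. lin J B (u i) x)"
  unfolding lin_def sum_distrib_right by (rule sum.swap)

lemma lin_lin: "lin J B (lin J' C v) x = lin J' (\<lambda>y. lin J B (C y)) v x"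
  unfolding lin_def[of J' C v, abs_def] lin_sum lin_scale by (simp add: lin_def)

text \<open>
  Gaussian elimination: an equation with a nonzero coefficient is solved for its unknown \<open>j0\<close> and
  substituted into the others, which removes one equation and one unknown.
\<close>

lemma underdetermined_system:
  fixes A :: "'s \<Rightarrow> 'j \<Rightarrow> 'a::field"
  assumes "finite S" "finite J" "card S < card J"
  shows "\<exists>x. (\<exists>j\<in>J. x j \<noteq> 0) \<and> (\<forall>s\<in>S. (\<Sum>j\<in>J. A s j * x j) = 0)"
  using assms
proof (induction S arbitrary: A J rule: finite_induct)
  case empty
  then obtain j where "j \<in> J" by fastforce
  then show ?case by (intro exI[of _ "\<lambda>_. 1"]) auto
next
  case (insert s0 S)
  show ?case
  proof (cases "\<forall>j\<in>J. A s0 j = 0")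
    case True
    from insert obtain x where "\<exists>j\<in>J. x j \<noteq> 0" "\<forall>s\<in>S. (\<Sum>j\<in>J. A s j * x j) = 0"
      by (metis Suc_lessD card_insert_disjoint)
    with True show ?thesis by auto
  next
    case False
    then obtain j0 where j0: "j0 \<in> J" "A s0 j0 \<noteq> 0" by blast
    define J' where "J' = J - {j0}"
    have J': "finite J'" "j0 \<notin> J'" "J = insert j0 J'" using insert.prems j0 by (auto simp: J'_def)
    have "card S < card J'" using insert.prems insert.hyps J' by simp
    from insert.IH[OF J'(1) this, of "\<lambda>s j. A s j - A s j0 / A s0 j0 * A s0 j"]
    obtain x where x: "\<exists>j\<in>J'. x j \<noteq> 0"
      "\<forall>s\<in>S. (\<Sum>j\<in>J'. (A s j - A s j0 / A s0 j0 * A s0 j) * x j) = 0" by blast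
    define c where "c = - (\<Sum>j\<in>J'. A s0 j * x j) / A s0 j0"
    define y where "y = x(j0 := c)"
    have sum_y: "(\<Sum>j\<in>J. A s j * y j) = A s j0 * c + (\<Sum>j\<in>J'. A s j * x j)" for s
    proof -
      have "(\<Sum>j\<in>J'. A s j * y j) = (\<Sum>j\<in>J'. A s j * x j)"
        by (rule sum.cong) (use J' in \<open>auto simp: y_def\<close>)
      then show ?thesis using J' by (simp add: y_def)
    qed
    have "(\<Sum>j\<in>J. A s j * y j) = 0" if "s \<in> insert s0 S" for s
    proof (cases "s = s0")
      case True
      then show ?thesis using j0 by (simp add: sum_y c_def)
    next
      case False
      then have "0 = (\<Sum>j\<in>J'. (A s j - A s j0 / A s0 j0 * A s0 j) * x j)" using x that by auto
      also have "\<dots> = (\<Sum>j\<in>J'. A s j * x j) - A s j0 / A s0 j0 * (\<Sum>j\<in>J'. A s0 j * x j)"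
        by (simp add: left_diff_distrib sum_subtractf sum_distrib_left mult.assoc)
      finally show ?thesis unfolding sum_y c_def by (simp add: algebra_simps)
    qed
    moreover have "\<exists>j\<in>J. y j \<noteq> 0" using x J' by (auto simp: y_def)
    ultimately show ?thesis by blast
  qed
qed

text \<open>
  The vectors \<open>f s\<close>, together with \<open>k\<close> and \<open>v\<close>, are one more than the dimension and hence
  linearly dependent. Applying \<open>\<mu> t\<close> to a dependency isolates the coefficient of \<open>f t\<close>, which
  is therefore zero, and a dependency between \<open>k\<close> and \<open>v\<close> remains.
\<close>

lemma common_kernel_one_dimensional:
  fixes \<mu> f :: "'s \<Rightarrow> 'j \<Rightarrow> 'a::field"
  assumes fin: "finite S" "finite J" and card: "card J = Suc (card S)"
    and dual: "\<And>s t. s \<in> S \<Longrightarrow> t \<in> S \<Longrightarrow> (\<Sum>j\<in>J. \<mu> s j * f t j) = (if s = t then 1 else 0)"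
    and k: "\<exists>j\<in>J. k j \<noteq> 0" "\<And>s. s \<in> S \<Longrightarrow> (\<Sum>j\<in>J. \<mu> s j * k j) = 0"
    and v: "\<And>s. s \<in> S \<Longrightarrow> (\<Sum>j\<in>J. \<mu> s j * v j) = 0"
  shows "\<exists>c. \<forall>j\<in>J. v j = c * k j"
proof -
  \<comment> \<open>\<open>U\<close> indexes the family: \<open>None\<close> stands for \<open>v\<close>, \<open>Some None\<close> for \<open>k\<close>, and
     \<open>Some (Some s)\<close> for \<open>f s\<close>.\<close>
  define U where "U = insert None (insert (Some None) ((\<lambda>s. Some (Some s)) ` S))"
  define w where "w j u = (case u of None \<Rightarrow> v j | Some None \<Rightarrow> k j | Some (Some s) \<Rightarrow> f s j)" for j u
  have "card ((\<lambda>s. Some (Some s)) ` S) = card S" by (intro card_image) (auto simp: inj_on_def)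
  then have "card U = Suc (Suc (card S))" using fin by (simp add: U_def image_iff)
  moreover have "finite U" using fin by (simp add: U_def)
  ultimately obtain x where x: "\<exists>u\<in>U. x u \<noteq> 0" "\<And>j. j \<in> J \<Longrightarrow> (\<Sum>u\<in>U. w j u * x u) = 0"
    using underdetermined_system[OF fin(2), of U w] card by auto
  have "(\<Sum>u\<in>U. w j u * x u) = v j * x None + (k j * x (Some None) +
      (\<Sum>s\<in>S. f s j * x (Some (Some s))))" for j
    using fin by (simp add: U_def w_def image_iff sum.reindex inj_on_def)
  then have rel: "v j * x None + (k j * x (Some None) + (\<Sum>s\<in>S. f s j * x (Some (Some s)))) = 0"
    if "j \<in> J" for j using x(2)[OF that] by simp
  have xs: "x (Some (Some t)) = 0" if "t \<in> S" for t
  proof -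
    have "0 = (\<Sum>j\<in>J. \<mu> t j * (v j * x None + (k j * x (Some None) + (\<Sum>s\<in>S. f s j * x (Some (Some s))))))"
      using rel by simp
    also have "\<dots> = (\<Sum>j\<in>J. \<mu> t j * v j) * x None + (\<Sum>j\<in>J. \<mu> t j * k j) * x (Some None)
       + (\<Sum>j\<in>J. \<Sum>s\<in>S. \<mu> t j * f s j * x (Some (Some s)))"
      by (simp add: algebra_simps sum.distrib sum_distrib_left)
    also have "(\<Sum>j\<in>J. \<Sum>s\<in>S. \<mu> t j * f s j * x (Some (Some s))) =
       (\<Sum>s\<in>S. (\<Sum>j\<in>J. \<mu> t j * f s j) * x (Some (Some s)))"
      by (subst sum.swap) (simp add: sum_distrib_right)
    also have "\<dots> = x (Some (Some t))"
      using dual that fin by (simp add: if_distrib[of "\<lambda>t. t * _"] cong: if_cong)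
    finally show ?thesis using k(2) v that by simp
  qed
  have vk: "v j * x None + k j * x (Some None) = 0" if "j \<in> J" for j
    using rel[OF that] xs by simp
  have "x None \<noteq> 0"
  proof
    assume "x None = 0"
    then have "x (Some None) = 0" using vk k(1) by force
    then show False using \<open>x None = 0\<close> xs x(1) by (auto simp: U_def)
  qed
  then have "v j = - x (Some None) / x None * k j" if "j \<in> J" for j
    using vk[OF that] by (simp add: field_simps eq_neg_iff_add_eq_0)
  then show ?thesis by blast
qed

text \<open>
  The functionals \<open>\<mu> s\<close> are left eigenvectors of \<open>D\<close> and \<open>k\<close> spans their common kernel, so \<open>D\<close>
  is triangular in the basis formed by the \<open>f s\<close> and \<open>k\<close>. The trace is computed from the
  expansion of the identity in this basis: the unit vector at \<open>y\<close> is the sum of the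
  \<open>\<mu> s y * f s\<close> plus a multiple \<open>l y\<close> of \<open>k\<close>.
\<close>

lemma trace_eq_sum_eigenvalues:
  fixes \<mu> f :: "'s \<Rightarrow> 'j \<Rightarrow> 'a::field"
  assumes fin: "finite S" "finite J" and card: "card J = Suc (card S)"
    and dual: "\<And>s t. s \<in> S \<Longrightarrow> t \<in> S \<Longrightarrow> (\<Sum>j\<in>J. \<mu> s j * f t j) = (if s = t then 1 else 0)"
    and k: "\<exists>j\<in>J. k j \<noteq> 0" "\<And>s. s \<in> S \<Longrightarrow> (\<Sum>j\<in>J. \<mu> s j * k j) = 0"
    and D: "\<And>s v. s \<in> S \<Longrightarrow> (\<Sum>j\<in>J. \<mu> s j * lin J D v j) = d s * (\<Sum>j\<in>J. \<mu> s j * v j)"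
    and Dk: "\<And>j. j \<in> J \<Longrightarrow> lin J D k j = \<delta> * k j"
  shows "(\<Sum>j\<in>J. D j j) = (\<Sum>s\<in>S. d s) + \<delta>"
proof -
  have "\<exists>c. \<forall>j\<in>J. unit_vec y j - (\<Sum>s\<in>S. \<mu> s y * f s j) = c * k j" if "y \<in> J" for y
  proof (rule common_kernel_one_dimensional[OF fin card dual k])
    fix t assume t: "t \<in> S"
    have "(\<Sum>j\<in>J. \<mu> t j * (unit_vec y j - (\<Sum>s\<in>S. \<mu> s y * f s j))) =
      (\<Sum>j\<in>J. \<mu> t j * unit_vec y j) - (\<Sum>j\<in>J. \<Sum>s\<in>S. \<mu> s y * (\<mu> t j * f s j))"
      by (simp add: right_diff_distrib sum_subtractf sum_distrib_left algebra_simps)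
    also have "(\<Sum>j\<in>J. \<mu> t j * unit_vec y j) = \<mu> t y"
      using fin that by (simp add: unit_vec_def if_distrib cong: if_cong)
    also have "(\<Sum>j\<in>J. \<Sum>s\<in>S. \<mu> s y * (\<mu> t j * f s j)) = (\<Sum>s\<in>S. \<mu> s y * (\<Sum>j\<in>J. \<mu> t j * f s j))"
      by (subst sum.swap) (simp add: sum_distrib_left)
    also have "\<dots> = (\<Sum>s\<in>S. \<mu> s y * (if t = s then 1 else 0))"
      using t dual by (intro sum.cong) auto
    also have "\<dots> = \<mu> t y" using t fin by (simp add: if_distrib cong: if_cong)
    finally show "(\<Sum>j\<in>J. \<mu> t j * (unit_vec y j - (\<Sum>s\<in>S. \<mu> s y * f s j))) = 0" by simp
  qed auto
  then obtain l where "unit_vec y j - (\<Sum>s\<in>S. \<mu> s y * f s j) = l y * k j" if "y \<in> J" "j \<in> J" for y j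
    by metis
  then have l: "unit_vec y j = (\<Sum>s\<in>S. \<mu> s y * f s j) + l y * k j" if "y \<in> J" "j \<in> J" for y j
    using that by (simp add: diff_eq_eq add.commute)
  have Dy: "D y x = (\<Sum>s\<in>S. \<mu> s y * lin J D (f s) x) + l y * (\<delta> * k x)" if "y \<in> J" "x \<in> J" for x y
  proof -
    have "D y x = lin J D (unit_vec y) x" using fin that by (simp add: lin_unit_vec)
    also have "\<dots> = lin J D (\<lambda>j. (\<Sum>s\<in>S. \<mu> s y * f s j) + l y * k j) x"
      using l that by (intro lin_cong) auto
    also have "\<dots> = (\<Sum>s\<in>S. \<mu> s y * lin J D (f s) x) + l y * lin J D k x"
      by (simp add: lin_add lin_sum lin_scale)
    finally show ?thesis using Dk that by simp
  qed
  have "(\<Sum>x\<in>J. D x x) = (\<Sum>s\<in>S. \<Sum>x\<in>J. \<mu> s x * lin J D (f s) x) + \<delta> * (\<Sum>x\<in>J. l x * k x)"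
    by (subst sum.swap) (simp add: Dy sum.distrib sum_distrib_left algebra_simps)
  also have "(\<Sum>s\<in>S. \<Sum>x\<in>J. \<mu> s x * lin J D (f s) x) = (\<Sum>s\<in>S. d s)"
    by (rule sum.cong) (simp_all add: D dual)
  \<comment> \<open>Expanding \<open>k\<close> itself: its \<open>f s\<close> components vanish, so the functional \<open>l\<close> takes the
     value 1 on \<open>k\<close>.\<close>
  also have "(\<Sum>x\<in>J. l x * k x) = 1"
  proof -
    obtain y where y: "y \<in> J" "k y \<noteq> 0" using k by blast
    have "k y = (\<Sum>x\<in>J. k x * unit_vec x y)"
      using fin y by (simp add: unit_vec_def if_distrib cong: if_cong)
    also have "\<dots> = (\<Sum>x\<in>J. k x * ((\<Sum>s\<in>S. \<mu> s x * f s y) + l x * k y))"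
      using l y by simp
    also have "\<dots> = (\<Sum>x\<in>J. \<Sum>s\<in>S. f s y * (\<mu> s x * k x)) + (\<Sum>x\<in>J. l x * k x) * k y"
      by (simp add: algebra_simps sum.distrib sum_distrib_left)
    also have "(\<Sum>x\<in>J. \<Sum>s\<in>S. f s y * (\<mu> s x * k x)) = (\<Sum>s\<in>S. f s y * (\<Sum>x\<in>J. \<mu> s x * k x))"
      by (subst sum.swap) (simp add: sum_distrib_left)
    also have "\<dots> = 0" using k by simp
    finally show ?thesis using y by simp
  qed
  finally show ?thesis by simp
qed

section \<open>Multiplication operators modulo the equation and its conjugate\<close>

text \<open>
  An array \<open>v\<close>, of which only the entries with indices in \<open>box\<close> matter, stands for the sum of
  \<open>v (i, j) * z^i * w^j\<close>, and \<open>ev z\<close> evaluates it at \<open>w = cnj z\<close>. The two rewrite rules are the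
  equation in \<open>is_zero\<close> for \<open>z^n\<close> and its conjugate for \<open>w^n\<close>.
\<close>

locale conjugate_reduction =
  fixes n :: nat and a b :: "nat \<Rightarrow> complex"
  assumes n2: "2 \<le> n"
begin

definition box :: "(nat \<times> nat) set" where "box = {..<n} \<times> {..<n}"

text \<open>
  Conjugating the coefficients and exchanging \<open>z\<close> and \<open>w\<close> is an antilinear involution which
  exchanges the two rewrite rules. Everything concerning \<open>w\<close> is obtained from \<open>z\<close> through it.
\<close>

definition conj_swap :: "(nat \<times> nat \<Rightarrow> complex) \<Rightarrow> nat \<times> nat \<Rightarrow> complex" where
  "conj_swap v = (\<lambda>(i, j). cnj (v (j, i)))"

definition ev :: "complex \<Rightarrow> (nat \<times> nat \<Rightarrow> complex) \<Rightarrow> complex" where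
  "ev z v = (\<Sum>x\<in>box. z ^ fst x * cnj z ^ snd x * v x)"

definition is_zero :: "complex \<Rightarrow> bool" where
  "is_zero z \<longleftrightarrow> z ^ n = (\<Sum>k<n-1. a k * z ^ k + b k * cnj z ^ k)"

text \<open>
  The reduced form of the pure power \<open>z^t\<close>. In the range \<open>t < 2 * n\<close> that is used, rewriting
  \<open>z^n\<close> once leaves lower powers of \<open>z\<close> and products \<open>z^(t - n) * w^k\<close> which are already reduced.
\<close>

fun power_vec :: "nat \<Rightarrow> nat \<times> nat \<Rightarrow> complex" where
  "power_vec t x = (if t < n then unit_vec (t, 0) x
     else (\<Sum>k<n-1. a k * power_vec (t - n + k) x + b k * unit_vec (t - n, k) x))"

declare power_vec.simps [simp del]

text \<open>
  Multiplication by \<open>z\<close> on basis monomials. Rewriting \<open>z^n * w^j\<close> leaves pure powers of \<open>w\<close> whose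
  exponents may be \<open>n\<close> or more; these are replaced by the specific reduced forms \<open>power_vec\<close>, so that
  the operator is compatible with them on the nose (\<open>Mz_power_vec\<close>) and not only after evaluation
  at zeros.
\<close>

definition Bz :: "nat \<times> nat \<Rightarrow> nat \<times> nat \<Rightarrow> complex" where
  "Bz = (\<lambda>(i, j). if Suc i < n then unit_vec (Suc i, j)
     else (\<lambda>x. \<Sum>k<n-1. a k * unit_vec (k, j) x + b k * conj_swap (power_vec (k + j)) x))"

lemma Bz_shift: "Suc i < n \<Longrightarrow> Bz (i, j) = unit_vec (Suc i, j)"
  by (simp add: Bz_def)

lemma Bz_wrap:
  "Suc i = n \<Longrightarrow> Bz (i, j) =
    (\<lambda>x. \<Sum>k<n-1. a k * unit_vec (k, j) x + b k * conj_swap (power_vec (k + j)) x)"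
  by (simp add: Bz_def)

definition Bw :: "nat \<times> nat \<Rightarrow> nat \<times> nat \<Rightarrow> complex" where
  "Bw = (\<lambda>(i, j). conj_swap (Bz (j, i)))"

abbreviation "Mz \<equiv> lin box Bz"
abbreviation "Mw \<equiv> lin box Bw"

lemma finite_box: "finite box" and card_box: "card box = n^2"
  by (simp_all add: box_def power2_eq_square)

lemma box_iff: "(i, j) \<in> box \<longleftrightarrow> i < n \<and> j < n"
  by (simp add: box_def)

lemma conj_swap_unit: "conj_swap (unit_vec (i, j)) = unit_vec (j, i)"
  by (auto simp: conj_swap_def unit_vec_def)

lemma sum_box_swap: "(\<Sum>x\<in>box. g x) = (\<Sum>x\<in>box. g (prod.swap x))"
  by (rule sum.reindex_bij_witness[of _ prod.swap prod.swap]) (auto simp: box_def)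

lemma ev_conj_swap: "ev z (conj_swap v) = cnj (ev z v)"
  unfolding ev_def by (subst sum_box_swap) (simp add: conj_swap_def case_prod_beta mult_ac)

lemma Mw_conj_swap: "Mw v = conj_swap (Mz (conj_swap v))"
proof
  fix x
  show "Mw v x = conj_swap (Mz (conj_swap v)) x"
    unfolding lin_def conj_swap_def[of "\<lambda>x. sum _ _"]
    by (subst sum_box_swap) (simp add: conj_swap_def Bw_def case_prod_beta prod.swap_def)
qed

lemma ev_scale: "ev z (\<lambda>x. c * v x) = c * ev z v"
  by (simp add: ev_def sum_distrib_left algebra_simps)

lemma ev_add: "ev z (\<lambda>x. u x + v x) = ev z u + ev z v"
  by (simp add: ev_def sum.distrib algebra_simps)

lemma ev_sum: "ev z (\<lambda>x. \<Sum>i\<in>I. u i x) = (\<Sum>i\<in>I. ev z (u i))"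
  unfolding ev_def sum_distrib_left by (rule sum.swap)

lemma ev_unit: "i < n \<Longrightarrow> j < n \<Longrightarrow> ev z (unit_vec (i, j)) = z ^ i * cnj z ^ j"
  using finite_box by (simp add: ev_def unit_vec_def if_distrib box_iff cong: if_cong)

lemma ev_power_vec: "is_zero z \<Longrightarrow> t < 2 * n \<Longrightarrow> ev z (power_vec t) = z ^ t"
proof (induction t rule: less_induct)
  case (less t)
  show ?case
  proof (cases "t < n")
    case True
    then have "power_vec t = unit_vec (t, 0)" by (auto simp: power_vec.simps[of t])
    then show ?thesis using n2 True by (simp add: ev_unit)
  next
    case False
    then have "power_vec t = (\<lambda>x. \<Sum>k<n-1. a k * power_vec (t - n + k) x + b k * unit_vec (t - n, k) x)"
      by (auto simp: power_vec.simps[of t])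
    then have "ev z (power_vec t) = (\<Sum>k<n-1. a k * ev z (power_vec (t - n + k)) + b k * ev z (unit_vec (t - n, k)))"
      by (simp add: ev_sum ev_add ev_scale)
    also have "\<dots> = (\<Sum>k<n-1. a k * z ^ (t - n + k) + b k * (z ^ (t - n) * cnj z ^ k))"
      using less False by (intro sum.cong) (auto simp: ev_unit)
    also have "\<dots> = z ^ (t - n) * z ^ n"
      using less.prems(1) by (simp add: is_zero_def sum_distrib_left algebra_simps power_add)
    finally show ?thesis using False by (simp flip: power_add)
  qed
qed

text \<open>
  The reduced form of \<open>z^t\<close> has degree at most \<open>n - 2\<close> in \<open>w\<close>, since the rule for \<open>z^n\<close> involves
  no \<open>w^(n - 1)\<close>. Together with \<open>Bz_support\<close> this is what makes the trace vanish.
\<close>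

lemma power_vec_support: "power_vec t (i, n - 1) = 0"
proof (induction t rule: less_induct)
  case (less t)
  then show ?case using n2
    by (auto simp: power_vec.simps[of t] unit_vec_def intro!: sum.neutral less)
qed

lemma Mz_unit: "i < n \<Longrightarrow> j < n \<Longrightarrow> Mz (unit_vec (i, j)) = Bz (i, j)"
  using finite_box by (auto simp: lin_unit_vec box_iff)

text \<open>
  The case \<open>Suc t = n\<close> is a wrap-around of \<open>z^(n - 1)\<close>, where the powers \<open>w^k\<close> that arise are still
  basis monomials; beyond it the recursion of \<open>power_vec\<close> commutes with multiplication by \<open>z\<close>.
\<close>

lemma Mz_power_vec: "Suc t < 2 * n \<Longrightarrow> Mz (power_vec t) = power_vec (Suc t)"
proof (induction t rule: less_induct)
  case (less t)
  consider "Suc t < n" | "Suc t = n" | "n \<le> t" by linarith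
  then show ?case
  proof cases
    case 1
    then have "power_vec t = unit_vec (t, 0)" by (auto simp: power_vec.simps[of t])
    then show ?thesis using 1 by (auto simp: Mz_unit Bz_shift power_vec.simps[of "Suc t"])
  next
    case 2
    then have low: "power_vec k = unit_vec (k, 0)" if "k \<le> t" for k
    proof -
      have "k < n" using 2 that by simp
      then show ?thesis by (auto simp: power_vec.simps[of k])
    qed
    have "power_vec (Suc t) x = (\<Sum>k<n-1. a k * power_vec k x + b k * unit_vec (0, k) x)" for x
      using 2 by (simp add: power_vec.simps[of n])
    also have "\<dots> x = (\<Sum>k<n-1. a k * unit_vec (k, 0) x + b k * conj_swap (power_vec k) x)" for x
      using 2 by (intro sum.cong) (auto simp: low conj_swap_unit)
    finally show ?thesis using 2 by (auto simp: low Mz_unit Bz_wrap)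
  next
    case 3
    then have "power_vec t = (\<lambda>x. \<Sum>k<n-1. a k * power_vec (t - n + k) x + b k * unit_vec (t - n, k) x)"
      by (auto simp: power_vec.simps[of t])
    then have "Mz (power_vec t) x = (\<Sum>k<n-1. a k * Mz (power_vec (t - n + k)) x + b k * Mz (unit_vec (t - n, k)) x)" for x
      by (simp add: lin_sum lin_add lin_scale)
    also have "\<dots> x = (\<Sum>k<n-1. a k * power_vec (Suc t - n + k) x + b k * unit_vec (Suc t - n, k) x)" for x
      using less 3 by (intro sum.cong) (auto simp: Mz_unit Bz_shift Suc_diff_le)
    also have "\<dots> x = power_vec (Suc t) x" for x
      using 3 by (simp add: power_vec.simps[of "Suc t"])
    finally show ?thesis by blast
  qed
qed

lemma ev_Bz:
  assumes "is_zero z" "x \<in> box"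
  shows "ev z (Bz x) = z * (z ^ fst x * cnj z ^ snd x)"
proof (cases x)
  case (Pair i j)
  with assms have ij: "i < n" "j < n" by (auto simp: box_iff)
  show ?thesis
  proof (cases "Suc i < n")
    case True
    then show ?thesis using Pair ij by (simp add: Bz_def ev_unit)
  next
    case False
    then have i: "n = Suc i" using ij by simp
    have "ev z (Bz x) = (\<Sum>k<n-1. a k * ev z (unit_vec (k, j)) + b k * cnj (ev z (power_vec (k + j))))"
      using False Pair by (simp add: Bz_def ev_sum ev_add ev_scale ev_conj_swap)
    also have "\<dots> = (\<Sum>k<n-1. a k * (z ^ k * cnj z ^ j) + b k * cnj (z ^ (k + j)))"
      using ij assms by (intro sum.cong) (auto simp: ev_unit ev_power_vec)
    also have "\<dots> = z ^ n * cnj z ^ j"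
      unfolding assms(1)[unfolded is_zero_def] sum_distrib_right
      by (intro sum.cong) (simp_all add: algebra_simps power_add)
    finally show ?thesis using Pair by (simp add: i)
  qed
qed

lemma ev_Mz:
  assumes "is_zero z"
  shows "ev z (Mz v) = z * ev z v"
proof -
  have "ev z (Mz v) = (\<Sum>y\<in>box. v y * ev z (Bz y))"
    by (simp add: lin_def[abs_def] ev_sum ev_scale)
  also have "\<dots> = (\<Sum>y\<in>box. v y * (z * (z ^ fst y * cnj z ^ snd y)))"
    by (intro sum.cong refl) (simp add: ev_Bz assms)
  finally show ?thesis by (simp add: ev_def sum_distrib_left algebra_simps)
qed

lemma ev_Mw: "is_zero z \<Longrightarrow> ev z (Mw v) = cnj z * ev z v"
  by (simp add: Mw_conj_swap ev_conj_swap ev_Mz)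

text \<open>
  A reduced \<open>z^n * w^j\<close> has degree at most \<open>n - 2\<close> in \<open>z\<close>, because the rule for \<open>z^n\<close> contains
  no \<open>z^(n - 1)\<close> and the reduced powers of \<open>w\<close> do not contain it either, by the conjugate of
  \<open>power_vec_support\<close>.
\<close>

lemma Bz_support: "Bz (n - 1, j) (n - 1, j') = 0"
  using n2 by (auto simp: Bz_wrap unit_vec_def conj_swap_def power_vec_support[simplified] intro!: sum.neutral)

text \<open>
  Multiplication by \<open>z w\<close> sends no monomial to an array that contains this monomial again. If
  \<open>j < n - 1\<close>, the exponent of \<open>w\<close> is raised first, and the multiplication by \<open>z\<close> then either
  shifts or lands in degree at most \<open>n - 2\<close> in \<open>z\<close>. If \<open>j = n - 1\<close> and \<open>i < n - 1\<close>, the rule for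
  \<open>w^n\<close> yields monomials of low degree in \<open>w\<close> and pure powers of \<open>z\<close>, for which multiplication by
  \<open>z\<close> keeps the degree in \<open>w\<close> at most \<open>n - 2\<close>. In the corner \<open>i = j = n - 1\<close>, the
  multiplication by \<open>w\<close> leaves degree at most \<open>n - 2\<close> in \<open>w\<close>, and from there \<open>z\<close> either shifts,
  keeping this degree, or lands in degree at most \<open>n - 2\<close> in \<open>z\<close>.
\<close>

lemma Mz_Bw_diagonal:
  assumes "x \<in> box"
  shows "Mz (Bw x) x = 0"
proof (cases x)
  case (Pair i j)
  with assms have ij: "i < n" "j < n" by (auto simp: box_iff)
  consider "Suc j < n" | "Suc i < n" "Suc j = n" | "Suc i = n" "Suc j = n" using ij by linarith
  then show ?thesis
  proof cases
    case 1
    then have "Mz (Bw x) = Bz (i, Suc j)"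
      using Pair ij by (auto simp: Bw_def Bz_shift conj_swap_unit Mz_unit)
    moreover have "Bz (i, Suc j) (i, j) = 0"
    proof (cases "Suc i < n")
      case False
      then have "i = n - 1" using ij by simp
      then show ?thesis by (simp only: Bz_support)
    qed (simp add: Bz_def unit_vec_def)
    ultimately show ?thesis using Pair by simp
  next
    case 2
    have "Bw x = (\<lambda>y. \<Sum>k<n-1. cnj (a k) * unit_vec (i, k) y + cnj (b k) * power_vec (k + i) y)"
      using 2 Pair by (auto simp: Bw_def Bz_def conj_swap_def unit_vec_def fun_eq_iff intro!: sum.cong)
    then have "Mz (Bw x) x = (\<Sum>k<n-1. cnj (a k) * Mz (unit_vec (i, k)) x + cnj (b k) * Mz (power_vec (k + i)) x)"
      by (simp add: lin_sum lin_add lin_scale)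
    also have "\<dots> = 0"
    proof (intro sum.neutral ballI)
      fix k assume "k \<in> {..<n-1}"
      then have k: "k < n - 1" by simp
      have "Mz (unit_vec (i, k)) x = 0" using k 2 Pair by (simp add: Mz_unit Bz_shift unit_vec_def)
      moreover have "Mz (power_vec (k + i)) x = 0"
      proof -
        have "j = n - 1" using 2 by simp
        then have "power_vec (Suc (k + i)) (i, j) = 0" by (simp only: power_vec_support)
        then show ?thesis using k 2 Pair by (simp add: Mz_power_vec)
      qed
      ultimately show "cnj (a k) * Mz (unit_vec (i, k)) x + cnj (b k) * Mz (power_vec (k + i)) x = 0" by simp
    qed
    finally show ?thesis .
  next
    case 3
    then have x: "x = (n - 1, n - 1)" using Pair by auto
    have "Bw x y * Bz y x = 0" if "y \<in> box" for y
    proof (cases y)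
      case (Pair k l)
      show ?thesis
      proof (cases "l = n - 1")
        case True
        then have "Bw x y = 0" using Pair x Bz_support by (simp add: Bw_def conj_swap_def)
        then show ?thesis by simp
      next
        case False
        have "Bz y x = 0"
        proof (cases "Suc k < n")
          case True
          then show ?thesis using False Pair x by (simp add: Bz_def unit_vec_def)
        next
          case False
          then have "k = n - 1" using Pair that by (auto simp: box_iff)
          then show ?thesis using Pair x Bz_support by simp
        qed
        then show ?thesis by simp
      qed
    qed
    then show ?thesis unfolding lin_def by (intro sum.neutral) blast
  qed
qed

section \<open>Evaluation at zeros and the trace\<close>

text \<open>
  Horner's scheme, with the multiplication by \<open>z\<close> replaced by \<open>Mz\<close>. Distinct zeros have distinct
  values of \<open>z\<close>, so polynomials in \<open>z\<close> alone already separate them.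
\<close>

lemma ev_surjective_poly: "\<exists>v. \<forall>z. is_zero z \<longrightarrow> ev z v = poly L z"
proof (induction L)
  case 0
  show ?case by (intro exI[of _ "\<lambda>_. 0"]) (simp add: ev_def)
next
  case (pCons c L)
  then obtain v where v: "\<forall>z. is_zero z \<longrightarrow> ev z v = poly L z" by blast
  show ?case
    using v n2 by (intro exI[of _ "\<lambda>x. c * unit_vec (0, 0) x + Mz v x"])
      (simp add: ev_add ev_scale ev_unit ev_Mz)
qed

lemma dual_vectors:
  assumes "finite S" "\<And>z. z \<in> S \<Longrightarrow> is_zero z"
  shows "\<exists>f. \<forall>s\<in>S. \<forall>t\<in>S. ev s (f t) = (if s = t then 1 else 0)"
proof -
  have "\<exists>v. \<forall>s\<in>S. ev s v = (if s = t then 1 else 0)" if "t \<in> S" for t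
  proof -
    \<comment> \<open>the Lagrange basis polynomial at \<open>t\<close>\<close>
    define L where "L = smult (inverse (\<Prod>u\<in>S-{t}. t - u)) (\<Prod>u\<in>S-{t}. [:- u, 1:])"
    have "poly L s = (if s = t then 1 else 0)" if "s \<in> S" for s
      using assms that by (auto simp: L_def poly_prod prod_zero_iff)
    then show ?thesis using ev_surjective_poly[of L] assms by metis
  qed
  then show ?thesis by metis
qed

text \<open>
  The kernel of evaluation at \<open>S\<close> is a line, invariant under \<open>Mz\<close>, \<open>Mw\<close> and \<open>conj_swap\<close>. As
  \<open>conj_swap\<close> is antilinear and carries \<open>Mz\<close> to \<open>Mw\<close>, the eigenvalues of \<open>Mz\<close> and \<open>Mw\<close> on the
  line are conjugate, so the missing contribution to the trace is \<open>\<alpha> * cnj \<alpha> \<ge> 0\<close>.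
\<close>

lemma card_zero_set_neq:
  assumes S: "finite S" "\<And>z. z \<in> S \<Longrightarrow> is_zero z"
  shows "Suc (card S) \<noteq> n^2"
proof
  assume card_S: "Suc (card S) = n^2"
  obtain f where f: "\<And>s t. s \<in> S \<Longrightarrow> t \<in> S \<Longrightarrow> ev s (f t) = (if s = t then 1 else 0)"
    using dual_vectors[OF S] by blast
  define \<mu> :: "complex \<Rightarrow> nat \<times> nat \<Rightarrow> complex" where "\<mu> s x = s ^ fst x * cnj s ^ snd x" for s x
  have ev_\<mu>: "(\<Sum>x\<in>box. \<mu> s x * v x) = ev s v" for s v by (simp add: ev_def \<mu>_def)
  obtain k where k: "\<exists>x\<in>box. k x \<noteq> 0" "\<And>s. s \<in> S \<Longrightarrow> ev s k = 0"
    using underdetermined_system[OF S(1) finite_box, of \<mu>] card_S card_box unfolding ev_\<mu> by auto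
  have kernel: "\<exists>c. \<forall>x\<in>box. v x = c * k x" if "\<And>s. s \<in> S \<Longrightarrow> ev s v = 0" for v
    using common_kernel_one_dimensional[OF S(1) finite_box, of \<mu> f k v] f k that card_S card_box
    unfolding ev_\<mu> by simp
  obtain \<alpha> where \<alpha>: "\<And>x. x \<in> box \<Longrightarrow> Mz k x = \<alpha> * k x"
    using kernel[of "Mz k"] k S ev_Mz by force
  obtain \<gamma> where \<gamma>: "\<And>x. x \<in> box \<Longrightarrow> conj_swap k x = \<gamma> * k x"
    using kernel[of "conj_swap k"] k by (auto simp: ev_conj_swap)
  have Mz_conj_swap: "Mz (conj_swap k) x = \<alpha> * conj_swap k x" if "x \<in> box" for x
  proof -
    have "Mz (conj_swap k) x = Mz (\<lambda>x. \<gamma> * k x) x" by (intro lin_cong) (simp add: \<gamma>)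
    then show ?thesis using that by (simp add: lin_scale \<alpha> \<gamma>)
  qed
  have Mw_k: "Mw k x = cnj \<alpha> * k x" if "x \<in> box" for x
  proof (cases x)
    case (Pair i j)
    then have "Mz (conj_swap k) (j, i) = \<alpha> * conj_swap k (j, i)"
      using that by (intro Mz_conj_swap) (simp add: box_iff)
    then show ?thesis unfolding Mw_conj_swap Pair by (simp add: conj_swap_def)
  qed
  define D where "D y = Mz (Bw y)" for y
  have lin_D: "lin box D v = Mz (Mw v)" for v
    by (simp add: lin_lin fun_eq_iff D_def[abs_def])
  have "(\<Sum>x\<in>box. D x x) = (\<Sum>s\<in>S. s * cnj s) + \<alpha> * cnj \<alpha>"
  proof (rule trace_eq_sum_eigenvalues[OF S(1) finite_box, of \<mu> f k D "\<lambda>s. s * cnj s"])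
    show "card box = Suc (card S)" using card_S card_box by simp
    show "\<exists>j\<in>box. k j \<noteq> 0" by (rule k)
    show "lin box D k x = \<alpha> * cnj \<alpha> * k x" if "x \<in> box" for x
    proof -
      have "lin box D k x = Mz (\<lambda>x. cnj \<alpha> * k x) x"
        unfolding lin_D by (intro lin_cong) (simp add: Mw_k)
      then show ?thesis using that by (simp add: lin_scale \<alpha>)
    qed
  qed (use f k S in \<open>simp_all add: ev_\<mu> lin_D ev_Mz ev_Mw\<close>)
  moreover have "(\<Sum>x\<in>box. D x x) = 0" by (simp add: D_def Mz_Bw_diagonal)
  ultimately have "complex_of_real ((\<Sum>s\<in>S. (cmod s)\<^sup>2) + (cmod \<alpha>)\<^sup>2) = 0"
    by (simp add: complex_norm_square del: of_real_power)
  then have "(\<Sum>s\<in>S. (cmod s)\<^sup>2) + (cmod \<alpha>)\<^sup>2 = 0" by (simp only: of_real_eq_0_iff)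
  then have "(\<Sum>s\<in>S. (cmod s)\<^sup>2) = 0"
    by (smt (verit) sum_nonneg zero_le_power2)
  then have "\<forall>s\<in>S. s = 0" using S(1) by (simp add: sum_nonneg_eq_0_iff)
  then have "S \<subseteq> {0}" by blast
  then have "card S \<le> 1" using card_mono[of "{0::complex}" S] by simp
  moreover have "n^2 \<ge> 2^2" using n2 by (intro power_mono) auto
  ultimately show False using card_S by simp
qed

end

section \<open>Removing the subleading coefficient\<close>

lemma pcompose_monom: "pcompose (monom c i) q = smult c (q ^ i)" for c :: "'a::comm_ring_1"
  by (induction i) (simp_all add: monom_0 monom_Suc pcompose_pCons)

lemma coeff_pcompose_linear:
  fixes p :: "'a::comm_ring_1 poly"
  assumes "degree p \<le> n"
  shows "coeff (pcompose p [:c, 1:]) j = (\<Sum>i\<le>n. coeff p i * coeff ([:c, 1:] ^ i) j)"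
proof -
  have "p = (\<Sum>i\<le>n. monom (coeff p i) i)"
    using assms by (simp add: poly_as_sum_of_monoms')
  also have "pcompose \<dots> [:c, 1:] = (\<Sum>i\<le>n. smult (coeff p i) ([:c, 1:] ^ i))"
    by (simp add: pcompose_sum pcompose_monom)
  finally show ?thesis by (simp add: coeff_sum)
qed

text \<open>
  Only the two top terms of \<open>p\<close> reach degree \<open>n - 1\<close>: the monic leading term contributes
  \<open>- n * c\<close> and the subleading one its own coefficient.
\<close>

lemma coeff_pcompose_shift_subleading:
  fixes p :: "'a::field_char_0 poly"
  assumes "degree p = n" "lead_coeff p = 1" "0 < n"
  shows "coeff (pcompose p [:- (coeff p (n - 1) / of_nat n), 1:]) (n - 1) = 0"
proof -
  obtain l where n: "n = Suc l" using assms by (cases n) auto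
  define c where "c = coeff p l / of_nat n"
  have "coeff ([:- c, 1:] ^ i) l = 0" if "i < l" for i
    using that by (intro coeff_eq_0) (simp add: degree_linear_power)
  then have "coeff (pcompose p [:- c, 1:]) l =
      coeff p n * coeff ([:- c, 1:] ^ n) l + coeff p l * coeff ([:- c, 1:] ^ l) l"
    using assms by (subst coeff_pcompose_linear[of _ n])
      (simp_all add: n atMost_Suc lessThan_Suc_atMost[symmetric])
  also have "\<dots> = 0"
    using assms by (simp add: n coeff_linear_poly_power c_def del: power_Suc of_nat_Suc)
  finally show ?thesis by (simp add: c_def n)
qed

lemma poly_eq_sum_lessThan:
  fixes p :: "'a::comm_semiring_1 poly"
  assumes "degree p < k"
  shows "poly p x = (\<Sum>i<k. coeff p i * x ^ i)"
  unfolding poly_altdef using assms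
  by (intro sum.mono_neutral_left) (auto simp: coeff_eq_0)

text \<open>
  The translation acts on \<open>p\<close>, a polynomial in the conjugate of \<open>z\<close>, by \<open>c\<close>, hence on \<open>z\<close> and \<open>q\<close>
  by \<open>cnj c\<close>. Conjugating the translated equation gives the form required by \<open>is_zero\<close>.
\<close>

lemma card_zeros_neq:
  fixes p q :: "complex poly"
  assumes deg: "degree q + 2 \<le> n" "degree p = n" "lead_coeff p = 1"
    and S: "finite S" "\<And>z. z \<in> S \<Longrightarrow> poly q z + poly p (cnj z) = 0"
  shows "Suc (card S) \<noteq> n^2"
proof -
  define c where "c = coeff p (n - 1) / of_nat n"
  define P where "P = pcompose p [:- c, 1:]"
  define Q where "Q = pcompose q [:- cnj c, 1:]"
  interpret conjugate_reduction n "\<lambda>k. - cnj (coeff P k)" "\<lambda>k. - cnj (coeff Q k)"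
    by unfold_locales (use deg in simp)
  have P: "degree P = n" "coeff P (n - 1) = 0" "coeff P n = 1"
    using deg coeff_pcompose_shift_subleading[of p n] lead_coeff_comp[of "[:- c, 1:]" p]
    by (simp_all add: P_def c_def degree_pcompose)
  have Q: "degree Q < n - 1" using deg by (simp add: Q_def degree_pcompose)
  have "is_zero (z + cnj c)" if "z \<in> S" for z
  proof -
    define u where "u = z + cnj c"
    obtain l where l: "n = Suc l" using deg by (cases n) auto
    have "0 = poly Q u + poly P (cnj u)"
      using S(2)[OF that] by (simp add: P_def Q_def poly_pcompose u_def)
    also have "poly P (cnj u) = (\<Sum>k<Suc n. coeff P k * cnj u ^ k)"
      by (rule poly_eq_sum_lessThan) (simp add: P)
    also have "\<dots> = (\<Sum>k<n-1. coeff P k * cnj u ^ k) + cnj u ^ n"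
      using P by (simp add: l)
    also have "poly Q u = (\<Sum>k<n-1. coeff Q k * u ^ k)"
      by (rule poly_eq_sum_lessThan) (rule Q)
    finally have "cnj 0 = cnj ((\<Sum>k<n-1. coeff Q k * u ^ k) + ((\<Sum>k<n-1. coeff P k * cnj u ^ k) + cnj u ^ n))"
      by (rule arg_cong)
    then have "u ^ n = - (\<Sum>k<n-1. cnj (coeff P k) * u ^ k) - (\<Sum>k<n-1. cnj (coeff Q k) * cnj u ^ k)"
      by (simp add: eq_neg_iff_add_eq_0 algebra_simps)
    then show ?thesis
      by (simp add: is_zero_def u_def[symmetric] sum_subtractf sum_negf)
  qed
  then have "Suc (card ((\<lambda>z. z + cnj c) ` S)) \<noteq> n^2"
    using S by (intro card_zero_set_neq) auto
  then show ?thesis by (simp add: card_image)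
qed

section \<open>The bound\<close>

theorem theorem1p1:
  fixes m n :: nat and p q :: "complex poly"
  assumes "m + 2 \<le> n"
    and "degree q = m" and "coeff q 0 = 0"
    and "degree p = n" and "lead_coeff p = 1"
  defines "Z \<equiv> {z :: complex. poly q z + poly p (cnj z) = 0}"
  shows "finite Z \<and>
    (if (of_nat n - 1) * (coeff p (n - 1))^2 - 2 * of_nat n * coeff p (n - 2) = 0
     then card Z \<le> n^2 - 1
     else card Z \<le> n^2 - 2)"
proof -
  have n: "2 \<le> n" using assms by simp
  then have n2: "2^2 \<le> n^2" by (intro power_mono) auto
  have neq: "card S \<noteq> n^2 - 1" if "finite S" "S \<subseteq> Z" for S
  proof -
    have "Suc (card S) \<noteq> n^2"
      by (rule card_zeros_neq[of q n p]) (use assms that in auto)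
    then show ?thesis using n2 by simp
  qed
  have fin: "finite Z"
    using infinite_arbitrarily_large[of Z "n^2 - 1"] neq by blast
  have "card Z < n^2 - 1"
  proof (rule ccontr)
    assume "\<not> card Z < n^2 - 1"
    then obtain S where "S \<subseteq> Z" "card S = n^2 - 1" "finite S"
      using obtain_subset_with_card_n[of "n^2 - 1" Z] by auto
    then show False using neq by blast
  qed
  then have "card Z \<le> n^2 - 2" "card Z \<le> n^2 - 1" by linarith+
  with fin show ?thesis by simp
qed

end
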